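(* Let $r$ be a positive integer with $r\equiv2,3,4,5,6\pmod8$. Then there do not exist rationals $x_1,\ldots,x_{r+1},y_1,\ldots,y_{r+1}$ such that \[ \sum_{i=1}^{r+1}x_iy_i^k=a_k,\qquad k=0,1,\dotsc,2r. \]
   Context: Here $a_k=\frac{1}{\sqrt{\pi}}\int_{-\infty}^{\infty}t^ke^{-t^2}\,dt$ for $k\ge 0$, i.e. $a_{2k}=\frac{(2k)!}{2^{2k}k!}$ and $a_{2k+1}=0$. Convention: $y^0=1$ for all $y$. *)

theory Defs
  imports "HOL-Probability.Probability"
begin

definition gauss_moment :: "nat \<Rightarrow> real" where
  "gauss_moment k = 1 / sqrt pi * (LINT t|lborel. t ^ k * exp (- t\<^sup>2))"

end

theory Submission
  imports Defs "HOL-Computational_Algebra.Polynomial"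
begin

text \<open>
  The proof combines the theory of Gaussian quadrature with the 2-adic valuation. Let
  \<open>r \<ge> 2\<close> and suppose that a rational formula with nodes \<open>y\<^sub>1, \<dots>, y\<^bsub>r+1\<^esub>\<close> exists.

  The functional \<open>Q(p) = \<Sum> x\<^sub>i p(y\<^sub>i)\<close> agrees with Gaussian integration in degree at most
  \<open>2r\<close>, and it kills every multiple of the node polynomial \<open>f = \<Prod> (X - y\<^sub>i)\<close>. Hence \<open>f\<close>, which
  is monic of degree \<open>r + 1\<close>, is orthogonal to all polynomials of degree less than \<open>r\<close>, and so
  \<open>f = H\<^bsub>r+1\<^esub> + c H\<^sub>r\<close> with monic Hermite polynomials and some rational \<open>c\<close>
  (\<open>node_polynomial_quasi_hermite\<close>).

  Now weigh the term \<open>p\<^sub>i X\<^sup>i\<close> of a polynomial by \<open>\<bar>p\<^sub>i\<bar>\<^sub>2 \<rho>\<^sup>i\<close> with \<open>\<rho> = \<surd>2\<close>; the maximum of these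
  weights is the Gauss norm of radius \<open>\<rho>\<close>. Because \<open>\<surd>2\<close> is not the 2-adic absolute value of a
  rational number, each factor \<open>X - y\<^sub>i\<close> has exactly one term of maximal weight, and this property
  passes to products (\<open>has_dominant_term_prod\<close>). So \<open>f\<close> has exactly one term of maximal weight.

  On the other hand, the leading term and the lowest nonzero term of \<open>H\<^sub>n\<close> both have the maximal
  weight \<open>\<rho>\<^sup>n\<close>, and for \<open>n \<ge> 2\<close> these are two different terms: in the language of Newton polygons,
  the nonzero roots of \<open>H\<^sub>n\<close> all have absolute value \<open>\<surd>2\<close>. Since \<open>H\<^bsub>r+1\<^esub>\<close> and \<open>H\<^sub>r\<close> involve powers of
  opposite parity, a dominant term of \<open>H\<^bsub>r+1\<^esub> + c H\<^sub>r\<close> would be a dominant term of one of the two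
  summands, whatever the value of \<open>c\<close> (\<open>not_has_dominant_term_quasi_hermite\<close>). This contradiction
  proves the theorem.
\<close>

section \<open>The 2-adic absolute value on the rationals\<close>

definition dyadic_norm :: "rat \<Rightarrow> real" where
  "dyadic_norm q = (if q = 0 then 0 else
     2 powi (int (multiplicity 2 (snd (quotient_of q))) - int (multiplicity 2 (fst (quotient_of q)))))"

lemma dyadic_norm_0 [simp]: "dyadic_norm 0 = 0"
  by (simp add: dyadic_norm_def)

lemma dyadic_norm_of_int_divide:
  assumes "a \<noteq> 0" "b \<noteq> 0"
  shows "dyadic_norm (of_int a / of_int b) = 2 powi (int (multiplicity 2 b) - int (multiplicity 2 a))"
proof -
  obtain c d where cd: "quotient_of (of_int a / of_int b) = (c, d)"
    by (cases "quotient_of (of_int a / of_int b)")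
  have d: "d > 0" using quotient_of_denom_pos[OF cd] .
  have eq: "of_int a / of_int b = (of_int c / of_int d :: rat)"
    using quotient_of_div[OF cd] .
  have c: "c \<noteq> 0" using eq assms d by auto
  have "(of_int (a * d) :: rat) = of_int (c * b)"
    using eq assms d by (simp add: field_simps)
  hence "a * d = c * b" by (simp only: of_int_eq_iff)
  hence "multiplicity 2 (a * d) = multiplicity 2 (c * b)" by simp
  hence "multiplicity 2 a + multiplicity 2 d = multiplicity 2 c + multiplicity 2 b"
    using assms c d by (simp add: prime_elem_multiplicity_mult_distrib)
  hence "int (multiplicity 2 d) - int (multiplicity 2 c) = int (multiplicity 2 b) - int (multiplicity 2 a)"
    by linarith
  thus ?thesis using assms cd by (simp add: dyadic_norm_def)
qed

lemma rat_eq_of_int_divide: "\<exists>a b. b \<noteq> 0 \<and> (q :: rat) = of_int a / of_int b"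
  by (cases q) (metis Fract_of_int_quotient less_numeral_extra(3))

lemma dyadic_norm_mult: "dyadic_norm (p * q) = dyadic_norm p * dyadic_norm q"
proof (cases "p = 0 \<or> q = 0")
  case False
  obtain a b c d where ab: "b \<noteq> 0" "p = of_int a / of_int b" and cd: "d \<noteq> 0" "q = of_int c / of_int d"
    using rat_eq_of_int_divide by metis
  have nz: "a \<noteq> 0" "c \<noteq> 0" using False ab cd by auto
  have "p * q = of_int (a * c) / of_int (b * d)" using ab cd by simp
  thus ?thesis using nz ab cd
    by (simp add: dyadic_norm_of_int_divide prime_elem_multiplicity_mult_distrib
        algebra_simps flip: power_int_add del: of_int_mult)
qed auto

lemma dyadic_norm_nonneg [simp]: "dyadic_norm q \<ge> 0"
  by (simp add: dyadic_norm_def)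

lemma dyadic_norm_minus [simp]: "dyadic_norm (- q) = dyadic_norm q"
  using dyadic_norm_mult[of "-1" q] dyadic_norm_of_int_divide[of "-1" 1]
  by (simp add: multiplicity_unit_right)

lemma dyadic_norm_of_int_le: "dyadic_norm (of_int a) \<le> 1"
  using dyadic_norm_of_int_divide[of a 1] by (cases "a = 0") (auto simp: power_int_le_one power_int_minus inverse_le_1_iff)

lemma dyadic_norm_numbers: "dyadic_norm 1 = 1" "dyadic_norm (1 / 2) = 2"
  using dyadic_norm_of_int_divide[of 1 1] dyadic_norm_of_int_divide[of 1 2] by simp_all

lemma dyadic_norm_add_le: "dyadic_norm (p + q) \<le> max (dyadic_norm p) (dyadic_norm q)"
proof (cases "p = 0 \<or> q = 0 \<or> p + q = 0")
  case True
  thus ?thesis by (auto simp: le_max_iff_disj)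
next
  case False
  obtain a b c d where ab: "b \<noteq> 0" "p = of_int a / of_int b" and cd: "d \<noteq> 0" "q = of_int c / of_int d"
    using rat_eq_of_int_divide by metis
  define u v w where "u = a * d" and "v = c * b" and "w = b * d"
  have w: "w \<noteq> 0" using ab cd by (simp add: w_def)
  have p: "p = of_int u / of_int w" and q: "q = of_int v / of_int w"
    using ab cd by (auto simp: u_def v_def w_def)
  have pq: "p + q = of_int (u + v) / of_int w" by (simp add: p q add_divide_distrib)
  have nz: "u \<noteq> 0" "v \<noteq> 0" "u + v \<noteq> 0"
    using False pq p q by auto
  define m where "m = min (multiplicity 2 u) (multiplicity 2 v)"
  have "2 ^ m dvd u + v"
    by (intro dvd_add multiplicity_dvd') (simp_all add: m_def)
  hence "m \<le> multiplicity 2 (u + v)"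
    using nz by (intro multiplicity_geI) auto
  hence "dyadic_norm (p + q) \<le> 2 powi (int (multiplicity 2 w) - int m)"
    unfolding pq dyadic_norm_of_int_divide[OF nz(3) w]
    by (intro power_int_increasing) auto
  also have "\<dots> \<le> max (dyadic_norm p) (dyadic_norm q)"
    using nz w by (simp add: p q dyadic_norm_of_int_divide m_def min_def le_max_iff_disj)
  finally show ?thesis .
qed

lemma dyadic_norm_diff_le: "dyadic_norm (p - q) \<le> max (dyadic_norm p) (dyadic_norm q)"
  using dyadic_norm_add_le[of p "- q"] by simp

text \<open>In a triangle for an ultrametric the two longest sides are equal.\<close>

lemma dyadic_norm_diff_eq:
  assumes "dyadic_norm q < dyadic_norm p"
  shows "dyadic_norm (p - q) = dyadic_norm p"
  using dyadic_norm_diff_le[of p q] dyadic_norm_add_le[of "p - q" q] assms by auto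

text \<open>
  The square of a nonzero value is \<open>2\<close> to an even exponent. This is what makes \<open>\<surd>2\<close> a suitable
  radius: no rational root can sit on the circle of that radius.
\<close>

lemma dyadic_norm_neq_sqrt2: "dyadic_norm q \<noteq> sqrt 2"
proof
  assume *: "dyadic_norm q = sqrt 2"
  moreover have "q \<noteq> 0" using * by auto
  ultimately obtain k :: int where "dyadic_norm q = 2 powi k"
    unfolding dyadic_norm_def by metis
  hence "2 powi k = sqrt 2" using * by simp
  hence "(2 powi k)\<^sup>2 = (2 :: real)" by simp
  hence "(2::real) powi (2 * k) = 2 powi 1"
    by (simp add: power_int_mult power_int_power mult.commute)
  hence "\<not> 2 * k < 1" "\<not> 1 < 2 * k"
    using power_int_strict_increasing[of "2 * k" 1 "2::real"]
      power_int_strict_increasing[of 1 "2 * k" "2::real"] by auto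
  thus False by presburger
qed

section \<open>Weighted coefficients of split polynomials\<close>

text \<open>The maximum of these weights over all terms is the Gauss norm of radius \<open>\<rho>\<close>.\<close>

definition weighted_coeff :: "real \<Rightarrow> rat poly \<Rightarrow> nat \<Rightarrow> real" where
  "weighted_coeff \<rho> p i = dyadic_norm (coeff p i) * \<rho> ^ i"

definition has_dominant_term :: "real \<Rightarrow> rat poly \<Rightarrow> bool" where
  "has_dominant_term \<rho> p \<longleftrightarrow>
     (\<exists>j. \<forall>i. i \<noteq> j \<longrightarrow> weighted_coeff \<rho> p i < weighted_coeff \<rho> p j)"

lemma coeff_linear_factor_mult:
  fixes a :: rat
  shows "coeff ([:- a, 1:] * p) i = (case i of 0 \<Rightarrow> 0 | Suc k \<Rightarrow> coeff p k) - a * coeff p i"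
  by (simp add: coeff_pCons split: nat.split)

lemma weighted_coeff_nonneg: "\<rho> > 0 \<Longrightarrow> weighted_coeff \<rho> p i \<ge> 0"
  by (simp add: weighted_coeff_def)

text \<open>
  Multiplication by \<open>X\<close> scales all weights by \<open>\<rho>\<close> and shifts them by one place; multiplication by
  \<open>a\<close> scales them by \<open>\<bar>a\<bar>\<close> in place. As \<open>\<bar>a\<bar> \<noteq> \<rho>\<close>, one of the two contributions to
  \<open>(X - a) p\<close> dominates the other, so the dominant term of \<open>p\<close>, shifted if \<open>\<bar>a\<bar> < \<rho>\<close> and in place
  if \<open>\<bar>a\<bar> > \<rho>\<close>, survives as the dominant term of the product.
\<close>

lemma has_dominant_term_linear_factor:
  assumes \<rho>: "\<rho> > 0" and a: "dyadic_norm a \<noteq> \<rho>" and p: "has_dominant_term \<rho> p"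
  shows "has_dominant_term \<rho> ([:- a, 1:] * p)"
proof -
  let ?w = "weighted_coeff \<rho>"
  define N where "N = dyadic_norm a"
  have N0: "N \<ge> 0" by (simp add: N_def)
  define s where "s i = (case i of 0 \<Rightarrow> 0 | Suc k \<Rightarrow> coeff p k)" for i
  \<comment> \<open>\<open>u\<close> and \<open>v\<close> are the weights of \<open>X p\<close> and of \<open>a p\<close>.\<close>
  define u where "u i = dyadic_norm (s i) * \<rho> ^ i" for i
  define v where "v i = dyadic_norm (a * coeff p i) * \<rho> ^ i" for i
  obtain j where j: "\<And>i. i \<noteq> j \<Longrightarrow> ?w p i < ?w p j"
    using p by (auto simp: has_dominant_term_def)
  have pos: "?w p j > 0"
    using j[of "Suc j"] weighted_coeff_nonneg[OF \<rho>, of p "Suc j"] by simp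
  have u0: "u 0 = 0" by (simp add: u_def s_def)
  have uS: "u (Suc k) = \<rho> * ?w p k" for k
    by (simp add: u_def s_def weighted_coeff_def)
  have v: "v i = N * ?w p i" for i
    by (simp add: v_def N_def weighted_coeff_def dyadic_norm_mult)
  have coeff: "coeff ([:- a, 1:] * p) i = s i - a * coeff p i" for i
    unfolding coeff_linear_factor_mult s_def ..
  have le: "?w ([:- a, 1:] * p) i \<le> max (u i) (v i)" for i
  proof -
    have "?w ([:- a, 1:] * p) i \<le> max (dyadic_norm (s i)) (dyadic_norm (a * coeff p i)) * \<rho> ^ i"
      unfolding weighted_coeff_def coeff using \<rho> by (intro mult_right_mono dyadic_norm_diff_le) auto
    thus ?thesis by (simp add: u_def v_def max_def split: if_splits)
  qed
  have u_max: "u i < \<rho> * ?w p j" if "i \<noteq> Suc j" for i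
    using that j[of "i - 1"] \<rho> pos by (cases i) (auto simp: u0 uS)
  have u_le: "u i \<le> \<rho> * ?w p j" for i
    using u_max[of i] uS[of j] by (cases "i = Suc j") auto
  have v_le: "v i \<le> N * ?w p j" for i
    using j[of i] N0 by (cases "i = j") (auto simp: v intro!: mult_left_mono)
  show ?thesis
  proof (cases "N < \<rho>")
    case True
    have v_small: "v i < \<rho> * ?w p j" for i
      using v_le[of i] mult_strict_right_mono[OF True pos] by linarith
    have "dyadic_norm (a * coeff p (Suc j)) < dyadic_norm (s (Suc j))"
      using v_small[of "Suc j"] uS[of j] \<rho> unfolding u_def v_def
      by (metis mult_less_cancel_right_pos zero_less_power)
    hence "?w ([:- a, 1:] * p) (Suc j) = \<rho> * ?w p j"
      using uS[of j] unfolding u_def weighted_coeff_def coeff by (simp add: dyadic_norm_diff_eq)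
    moreover have "?w ([:- a, 1:] * p) i < \<rho> * ?w p j" if "i \<noteq> Suc j" for i
      using le[of i] u_max[OF that] v_small[of i] by linarith
    ultimately show ?thesis unfolding has_dominant_term_def by metis
  next
    case False
    hence gt: "\<rho> < N" using a by (simp add: N_def)
    have u_small: "u i < N * ?w p j" for i
      using u_le[of i] mult_strict_right_mono[OF gt pos] by linarith
    have v_max: "v i < N * ?w p j" if "i \<noteq> j" for i
      using j[OF that] gt \<rho> by (simp add: v)
    have "dyadic_norm (s j) < dyadic_norm (a * coeff p j)"
      using u_small[of j] v[of j] \<rho> unfolding u_def v_def
      by (metis mult_less_cancel_right_pos zero_less_power)
    hence "dyadic_norm (s j - a * coeff p j) = dyadic_norm (a * coeff p j)"
      by (metis dyadic_norm_diff_eq dyadic_norm_minus minus_diff_eq)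
    hence "?w ([:- a, 1:] * p) j = N * ?w p j"
      using v[of j] unfolding v_def weighted_coeff_def coeff by simp
    moreover have "?w ([:- a, 1:] * p) i < N * ?w p j" if "i \<noteq> j" for i
      using le[of i] v_max[OF that] u_small[of i] by linarith
    ultimately show ?thesis unfolding has_dominant_term_def by metis
  qed
qed

lemma has_dominant_term_prod:
  assumes "finite I" "\<rho> > 0" "\<And>i. i \<in> I \<Longrightarrow> dyadic_norm (y i) \<noteq> \<rho>"
  shows "has_dominant_term \<rho> (\<Prod>i\<in>I. [:- y i, 1:])"
  using assms
proof (induction I)
  case empty
  have "weighted_coeff \<rho> 1 i = (if i = 0 then 1 else 0)" for i
    by (simp add: weighted_coeff_def dyadic_norm_numbers)
  thus ?case by (auto simp: has_dominant_term_def intro!: exI[of _ 0])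
next
  case (insert i I)
  have "has_dominant_term \<rho> ([:- y i, 1:] * (\<Prod>i\<in>I. [:- y i, 1:]))"
    by (rule has_dominant_term_linear_factor) (use insert in auto)
  thus ?case using insert.hyps by simp
qed

section \<open>Monic Hermite polynomials\<close>

text \<open>
  These are \<open>2\<^sup>-\<^sup>n\<close> times the physicists' Hermite polynomials, orthogonal for the weight
  \<open>exp (- t\<^sup>2)\<close>. The recurrence through the derivative, rather than the three-term one, is the form
  that matches integration by parts, and it also controls the 2-adic size of the coefficients.
\<close>

fun hermite :: "nat \<Rightarrow> 'a :: field_char_0 poly" where
  "hermite 0 = 1"
| "hermite (Suc n) = pCons 0 (hermite n) - smult (1 / 2) (pderiv (hermite n))"

declare hermite.simps(2) [simp del] \<comment> \<open>\<open>hermite (Suc n)\<close> is mostly accessed by its coefficients.\<close>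

lemma coeff_hermite_Suc:
  "coeff (hermite (Suc n)) i =
     (case i of 0 \<Rightarrow> 0 | Suc k \<Rightarrow> coeff (hermite n) k) - 1 / 2 * of_nat (Suc i) * coeff (hermite n) (Suc i)"
  by (simp add: hermite.simps(2) coeff_pCons coeff_pderiv split: nat.split)

lemma coeff_hermite_eq_0: "i > n \<Longrightarrow> coeff (hermite n) i = 0"
  by (induction n arbitrary: i) (auto simp: coeff_hermite_Suc coeff_pCons split: nat.split)

lemma coeff_hermite_self: "coeff (hermite n) n = 1"
  by (induction n) (simp_all add: coeff_hermite_Suc coeff_hermite_eq_0)

lemma degree_hermite: "degree (hermite n) = n"
  by (intro antisym degree_le le_degree) (auto simp: coeff_hermite_eq_0 coeff_hermite_self)

lemma hermite_parity: "odd (n + i) \<Longrightarrow> coeff (hermite n) i = 0"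
  by (induction n arbitrary: i)
     (auto simp: coeff_hermite_Suc odd_pos split: nat.split)

text \<open>
  Each step of the recurrence raises all weights by a factor of at most \<open>\<surd>2\<close>: the shift up gives
  exactly \<open>\<surd>2\<close>, while \<open>- H\<^sub>n' / 2\<close> gains \<open>\<bar>1/2\<bar>\<^sub>2 = 2\<close> and loses \<open>\<surd>2\<close> through the shift down.
\<close>

lemma weighted_coeff_hermite_le: "weighted_coeff (sqrt 2) (hermite n) i \<le> sqrt 2 ^ n"
proof (induction n arbitrary: i)
  case 0
  show ?case by (cases i) (auto simp: weighted_coeff_def dyadic_norm_numbers)
next
  case (Suc n)
  define s :: rat where "s = (case i of 0 \<Rightarrow> 0 | Suc k \<Rightarrow> coeff (hermite n) k)"
  define t :: rat where "t = 1 / 2 * of_nat (Suc i) * coeff (hermite n) (Suc i)"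
  have s: "dyadic_norm s * sqrt 2 ^ i \<le> sqrt 2 ^ Suc n"
    using Suc[of "i - 1"] by (cases i) (auto simp: s_def weighted_coeff_def)
  have "dyadic_norm t \<le> 2 * dyadic_norm (coeff (hermite n) (Suc i))"
    using dyadic_norm_of_int_le[of "int (Suc i)"]
    unfolding t_def dyadic_norm_mult dyadic_norm_numbers
    by (intro mult_right_mono) auto
  hence "dyadic_norm t * sqrt 2 ^ i \<le> 2 * dyadic_norm (coeff (hermite n) (Suc i)) * sqrt 2 ^ i"
    by (intro mult_right_mono) auto
  also have "\<dots> = (sqrt 2 * sqrt 2) * (dyadic_norm (coeff (hermite n) (Suc i)) * sqrt 2 ^ i)"
    by (simp only: real_sqrt_mult_self abs_numeral mult.assoc)
  also have "\<dots> = sqrt 2 * (dyadic_norm (coeff (hermite n) (Suc i)) * sqrt 2 ^ Suc i)"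
    by (simp only: power_Suc mult_ac)
  also have "\<dots> \<le> sqrt 2 * sqrt 2 ^ n"
    using Suc[of "Suc i"] by (intro mult_left_mono) (auto simp: weighted_coeff_def)
  finally have t: "dyadic_norm t * sqrt 2 ^ i \<le> sqrt 2 ^ Suc n" by simp
  have "weighted_coeff (sqrt 2) (hermite (Suc n)) i = dyadic_norm (s - t) * sqrt 2 ^ i"
    unfolding weighted_coeff_def coeff_hermite_Suc s_def t_def ..
  also have "\<dots> \<le> max (dyadic_norm s) (dyadic_norm t) * sqrt 2 ^ i"
    by (intro mult_right_mono dyadic_norm_diff_le) auto
  also have "\<dots> \<le> sqrt 2 ^ Suc n" using s t by (simp add: max_def)
  finally show ?case .
qed

lemma weighted_coeff_hermite_top: "weighted_coeff (sqrt 2) (hermite n) n = sqrt 2 ^ n"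
  by (simp add: weighted_coeff_def coeff_hermite_self dyadic_norm_numbers)

text \<open>
  The index \<open>n mod 2\<close> is that of the lowest nonzero term. With \<open>H\<^sub>n = \<Sum> h\<^sub>i X\<^sup>i\<close>, the lowest coefficient of
  \<open>H\<^bsub>n+1\<^esub>\<close> is \<open>- h\<^sub>1 / 2\<close> if \<open>n\<close> is odd. If \<open>n\<close> is even it is \<open>h\<^sub>0 - h\<^sub>2\<close>, where the general
  bound on the weights gives \<open>\<bar>h\<^sub>2\<bar> \<le> \<bar>h\<^sub>0\<bar> / 2\<close> and
  hence \<open>\<bar>h\<^sub>0 - h\<^sub>2\<bar> = \<bar>h\<^sub>0\<bar>\<close>.
\<close>

lemma weighted_coeff_hermite_bottom: "weighted_coeff (sqrt 2) (hermite n) (n mod 2) = sqrt 2 ^ n"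
proof (induction n)
  case 0
  show ?case by (simp add: weighted_coeff_def dyadic_norm_numbers)
next
  case (Suc n)
  show ?case
  proof (cases "even n")
    case True
    have n: "n mod 2 = 0" and Sn: "Suc n mod 2 = 1" using True by presburger+
    have IH: "dyadic_norm (coeff (hermite n) 0) = sqrt 2 ^ n"
      using Suc n by (simp add: weighted_coeff_def)
    have "dyadic_norm (coeff (hermite n) 2) * 2 \<le> sqrt 2 ^ n"
      using weighted_coeff_hermite_le[of n 2] by (simp add: weighted_coeff_def)
    moreover have "sqrt 2 ^ n > 0" by simp
    ultimately have "dyadic_norm (coeff (hermite n) 2) < dyadic_norm (coeff (hermite n) 0)"
      using IH by linarith
    moreover have "coeff (hermite (Suc n)) 1 = coeff (hermite n) 0 - (coeff (hermite n) 2 :: rat)"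
      by (simp add: coeff_hermite_Suc numeral_2_eq_2)
    ultimately show ?thesis
      using IH Sn by (simp add: weighted_coeff_def dyadic_norm_diff_eq)
  next
    case False
    have n: "n mod 2 = 1" and Sn: "Suc n mod 2 = 0" using False by presburger+
    have "coeff (hermite (Suc n)) 0 = - (1 / 2 * coeff (hermite n) 1 :: rat)"
      by (simp add: coeff_hermite_Suc)
    hence "dyadic_norm (coeff (hermite (Suc n)) 0) = 2 * dyadic_norm (coeff (hermite n) 1)"
      by (simp only: dyadic_norm_minus dyadic_norm_mult dyadic_norm_numbers)
    moreover have "dyadic_norm (coeff (hermite n) 1) * sqrt 2 = sqrt 2 ^ n"
      using Suc n by (simp add: weighted_coeff_def)
    moreover have "2 * d = sqrt 2 * (d * sqrt 2)" for d :: real by simp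
    ultimately show ?thesis using Sn
      by (simp only: weighted_coeff_def power_0 mult_1_right power_Suc)
  qed
qed

text \<open>
  The terms whose index has the parity of the dominant one all come from one summand, which is a
  multiple of a Hermite polynomial and has two different terms of maximal weight.
\<close>

lemma not_has_dominant_term_quasi_hermite:
  assumes "r \<ge> 2"
  shows "\<not> has_dominant_term (sqrt 2) (hermite (Suc r) + smult c (hermite r))"
proof
  let ?f = "hermite (Suc r) + smult c (hermite r)"
  assume "has_dominant_term (sqrt 2) ?f"
  then obtain j where j: "\<And>i. i \<noteq> j \<Longrightarrow> weighted_coeff (sqrt 2) ?f i < weighted_coeff (sqrt 2) ?f j"
    by (auto simp: has_dominant_term_def)
  obtain n b where n: "n \<ge> 2" "\<And>i. even (i + j) \<Longrightarrow> coeff ?f i = b * coeff (hermite n) i"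
    "even (n + j)"
  proof (cases "even (r + j)")
    case True
    have "coeff ?f i = c * coeff (hermite r) i" if "even (i + j)" for i
      using hermite_parity[of "Suc r" i, where ?'a = rat] that True by simp
    with True show ?thesis using that[of r c] assms by blast
  next
    case False
    have "coeff ?f i = 1 * coeff (hermite (Suc r)) i" if "even (i + j)" for i
      using hermite_parity[of r i, where ?'a = rat] that False by simp
    with False show ?thesis using that[of "Suc r" 1] assms by simp
  qed
  have w: "weighted_coeff (sqrt 2) ?f i = dyadic_norm b * weighted_coeff (sqrt 2) (hermite n) i"
    if "even (i + j)" for i
    by (simp only: weighted_coeff_def n(2)[OF that] dyadic_norm_mult mult.assoc)
  \<comment> \<open>one of the two terms of maximal weight that differs from the supposed dominant term\<close>
  define i where "i = (if j = n then n mod 2 else n)"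
  have "n mod 2 < n" using n(1) mod_less_divisor[of 2 n] by linarith
  hence i: "i \<noteq> j" unfolding i_def by (metis less_irrefl)
  have "even (n mod 2 + n)" by presburger
  hence even_i: "even (i + j)" using n(3) unfolding i_def by metis
  have "weighted_coeff (sqrt 2) (hermite n) i = sqrt 2 ^ n"
    unfolding i_def using weighted_coeff_hermite_top weighted_coeff_hermite_bottom by metis
  hence "weighted_coeff (sqrt 2) ?f j \<le> weighted_coeff (sqrt 2) ?f i"
    using weighted_coeff_hermite_le[of n j] w[OF even_i] w[of j]
    by (simp add: mult_left_mono)
  thus False using j[OF i] by simp
qed

section \<open>Gaussian moments\<close>

text \<open>
  The recurrence is integration by parts; a generic field lets the same moments be
  used for the rational quadrature formula and for the real integral.
\<close>

fun hermite_moment :: "nat \<Rightarrow> 'a :: field_char_0" where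
  "hermite_moment 0 = 1"
| "hermite_moment (Suc 0) = 0"
| "hermite_moment (Suc (Suc k)) = of_nat (Suc k) / 2 * hermite_moment k"

lemma hermite_moment_even: "hermite_moment (2 * k) = fact (2 * k) / (2 ^ (2 * k) * fact k)"
proof (induction k)
  case (Suc k)
  have 1: "(of_nat (Suc (Suc (2 * k))) :: 'a) = 2 * of_nat (Suc k)" by simp
  have 2: "2 * Suc k = Suc (Suc (2 * k))" by simp
  show ?case
    unfolding 2 fact_Suc 1 hermite_moment.simps Suc
    by (simp add: field_simps del: of_nat_Suc)
qed simp

lemma hermite_moment_odd: "hermite_moment (2 * k + 1) = 0"
  by (induction k) simp_all

lemma of_rat_hermite_moment: "of_rat (hermite_moment k) = hermite_moment k"
  by (induction k rule: hermite_moment.induct) (simp_all add: of_rat_mult of_rat_divide of_rat_add)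

lemma gauss_moment_eq_hermite_moment: "gauss_moment k = hermite_moment k"
proof (cases "even k")
  case True
  then obtain m where k: "k = 2 * m" by (elim evenE)
  have "has_bochner_integral lborel (\<lambda>x::real. exp (-x\<^sup>2) * x ^ (2 * m))
          (2 * (sqrt pi / 2 * (fact (2 * m) / (2 ^ (2 * m) * fact m))))"
    using has_bochner_integral_even_function[OF gaussian_moment_even_pos[of m]] by simp
  from has_bochner_integral_integral_eq[OF this] show ?thesis
    unfolding gauss_moment_def k hermite_moment_even by (simp add: mult.commute[of "exp _"])
next
  case False
  then obtain m where k: "k = 2 * m + 1" by (elim oddE)
  have "has_bochner_integral lborel (\<lambda>x::real. exp (-x\<^sup>2) * x ^ (2 * m + 1)) 0"
    by (rule has_bochner_integral_odd_function[OF gaussian_moment_odd_pos]) simp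
  from has_bochner_integral_integral_eq[OF this] show ?thesis
    unfolding gauss_moment_def k hermite_moment_odd by (simp add: mult.commute[of "exp _"])
qed

section \<open>Quadrature for the Gaussian weight\<close>

locale gauss_quadrature =
  fixes I :: "'i set" and x y :: "'i \<Rightarrow> 'a :: field_char_0" and N :: nat
  assumes moments: "k \<le> N \<Longrightarrow> (\<Sum>i\<in>I. x i * y i ^ k) = hermite_moment k"
begin

definition Q :: "'a poly \<Rightarrow> 'a" where
  "Q p = (\<Sum>i\<in>I. x i * poly p (y i))"

lemma Q_0: "Q 0 = 0"
  by (simp add: Q_def)

lemma Q_diff: "Q (p - q) = Q p - Q q"
  by (simp add: Q_def algebra_simps sum_subtractf)

lemma Q_add: "Q (p + q) = Q p + Q q"
  by (simp add: Q_def algebra_simps sum.distrib)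

lemma Q_smult: "Q (smult c p) = c * Q p"
  by (simp add: Q_def sum_distrib_left algebra_simps)

lemma Q_eq_moments:
  assumes "degree p \<le> n" "n \<le> N"
  shows "Q p = (\<Sum>k\<le>n. coeff p k * hermite_moment k)"
proof -
  have "poly p z = (\<Sum>k\<le>n. coeff p k * z ^ k)" for z
    unfolding poly_altdef using assms(1)
    by (intro sum.mono_neutral_left) (auto simp: coeff_eq_0)
  hence "Q p = (\<Sum>i\<in>I. \<Sum>k\<le>n. coeff p k * (x i * y i ^ k))"
    by (simp add: Q_def sum_distrib_left mult_ac)
  also have "\<dots> = (\<Sum>k\<le>n. coeff p k * (\<Sum>i\<in>I. x i * y i ^ k))"
    by (subst sum.swap) (simp add: sum_distrib_left)
  also have "\<dots> = (\<Sum>k\<le>n. coeff p k * hermite_moment k)"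
    using assms(2) by (intro sum.cong) (auto simp: moments)
  finally show ?thesis .
qed

text \<open>The algebraic form of \<open>\<integral> t p(t) exp (- t\<^sup>2) dt = 1/2 \<integral> p'(t) exp (- t\<^sup>2) dt\<close>.\<close>

lemma Q_by_parts:
  assumes "degree p < N"
  shows "Q (pCons 0 p) = 1 / 2 * Q (pderiv p)"
proof -
  define n where "n = degree p"
  have "Q (pCons 0 p) = (\<Sum>k\<le>Suc n. coeff (pCons 0 p) k * hermite_moment k)"
    using assms degree_pCons_le[of 0 p] by (intro Q_eq_moments) (auto simp: n_def)
  also have "\<dots> = (\<Sum>k\<le>Suc n. coeff p k * hermite_moment (Suc k))"
    by (subst sum.atMost_Suc_shift) (simp add: n_def coeff_eq_0)
  also have "\<dots> = (\<Sum>k\<le>n. coeff p (Suc k) * hermite_moment (Suc (Suc k)))"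
    by (subst sum.atMost_Suc_shift) simp
  also have "\<dots> = 1 / 2 * (\<Sum>k\<le>n. coeff (pderiv p) k * hermite_moment k)"
    by (simp add: sum_distrib_left coeff_pderiv field_simps)
  also have "\<dots> = 1 / 2 * Q (pderiv p)"
    using assms by (subst Q_eq_moments[of _ n]) (auto simp: n_def degree_pderiv)
  finally show ?thesis .
qed

text \<open>
  This replaces Rodrigues' formula: integration by parts of \<open>t H\<^sub>n g\<close> produces \<open>H\<^sub>n' g / 2\<close>, which
  the recurrence cancels, and \<open>H\<^sub>n g' / 2\<close>. Orthogonality and the nonvanishing norms below follow.
\<close>

lemma Q_rodrigues:
  assumes "n + degree g \<le> N"
  shows "Q (hermite n * g) = (1 / 2) ^ n * Q ((pderiv ^^ n) g)"
  using assms
proof (induction n arbitrary: g)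
  case (Suc n)
  have deg: "degree (hermite n * g) < N"
    using Suc.prems degree_mult_le[of "hermite n" g] by (simp add: degree_hermite)
  have "Q (hermite (Suc n) * g) = Q (pCons 0 (hermite n * g)) - 1 / 2 * Q (pderiv (hermite n) * g)"
    by (simp add: hermite.simps(2) algebra_simps Q_diff Q_smult)
  also have "\<dots> = 1 / 2 * Q (hermite n * pderiv g)"
    unfolding Q_by_parts[OF deg] pderiv_mult Q_add by (simp add: algebra_simps)
  also have "\<dots> = (1 / 2) ^ Suc n * Q ((pderiv ^^ Suc n) g)"
    using Suc.prems by (subst Suc.IH) (auto simp: degree_pderiv funpow_swap1)
  finally show ?case .
qed simp

lemma Q_hermite_orthogonal:
  assumes "degree g < n" "n + degree g \<le> N"
  shows "Q (hermite n * g) = 0"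
proof -
  have "(pderiv ^^ n) g = 0"
    using assms(1) by (intro poly_eqI) (simp add: coeff_higher_pderiv coeff_eq_0)
  thus ?thesis using assms(2) by (simp add: Q_rodrigues Q_0)
qed

lemma Q_hermite_nondegenerate:
  assumes "g \<noteq> 0" "2 * degree g \<le> N"
  shows "Q (hermite (degree g) * g) \<noteq> 0"
proof -
  let ?n = "degree g" and ?D = "(pderiv ^^ degree g) g"
  have "Q ?D = coeff ?D 0"
    by (subst Q_eq_moments[of _ 0]) (simp_all add: degree_higher_pderiv)
  also have "\<dots> \<noteq> 0"
    using assms(1) by (simp add: coeff_higher_pderiv pochhammer_fact[symmetric])
  finally show ?thesis using assms(2) by (simp add: Q_rodrigues)
qed

text \<open>
  The node polynomial is orthogonal to everything, as far as \<open>Q\<close> can see. Subtracting suitable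
  multiples of \<open>H\<^bsub>r+1\<^esub>\<close> and \<open>H\<^sub>r\<close> leaves a remainder \<open>h\<close> of degree \<open>d < r\<close> that is still orthogonal
  to \<open>H\<^sub>d\<close>, which forces \<open>h = 0\<close>.
\<close>

lemma node_polynomial_quasi_hermite:
  assumes "finite I" "card I = Suc r" "2 * r \<le> N"
  shows "\<exists>c. (\<Prod>i\<in>I. [:- y i, 1:]) = hermite (Suc r) + smult c (hermite r)"
proof -
  define f where "f = (\<Prod>i\<in>I. [:- y i, 1:])"
  have deg: "degree f = Suc r"
    unfolding f_def using assms(2) by (subst degree_prod_eq_sum_degree) auto
  have "lead_coeff f = 1"
    unfolding f_def by (simp add: lead_coeff_prod)
  hence top: "coeff f (Suc r) = 1" using deg by simp
  have Qf: "Q (f * g) = 0" for g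
  proof -
    have "poly f (y i) = 0" if "i \<in> I" for i
      unfolding f_def poly_prod using assms(1) that by auto
    thus ?thesis by (simp add: Q_def)
  qed
  define c where "c = coeff f r - coeff (hermite (Suc r)) r"
  define h where "h = f - hermite (Suc r) - smult c (hermite r)"
  have coeff_h: "coeff h i = 0" if "i \<ge> r" for i
  proof -
    have "i = r \<or> i = Suc r \<or> i > Suc r" using that by linarith
    thus ?thesis
      by (auto simp: h_def c_def coeff_hermite_self coeff_hermite_eq_0 top deg coeff_eq_0)
  qed
  have "h = 0"
  proof (rule ccontr)
    assume "h \<noteq> 0"
    define d where "d = degree h"
    have "d < r" using \<open>h \<noteq> 0\<close> coeff_h[of d] unfolding d_def
      by (metis leading_coeff_0_iff not_le)
    have "Q (hermite d * h) = Q (f * hermite d) - Q (hermite (Suc r) * hermite d) - c * Q (hermite r * hermite d)"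
      by (simp add: h_def algebra_simps Q_diff Q_smult Q_add)
    also have "\<dots> = 0"
      using \<open>d < r\<close> assms(3)
      by (simp add: Qf Q_hermite_orthogonal degree_hermite)
    finally show False
      using Q_hermite_nondegenerate[OF \<open>h \<noteq> 0\<close>] \<open>d < r\<close> assms(3) by (simp add: d_def)
  qed
  hence "f = hermite (Suc r) + smult c (hermite r)"
    by (simp add: h_def algebra_simps)
  thus ?thesis unfolding f_def by blast
qed

end

section \<open>No rational quadrature formula\<close>

theorem no_rational_gauss_quadrature:
  fixes x y :: "'i \<Rightarrow> rat"
  assumes "r \<ge> 2" "finite I" "card I = Suc r"
  shows "\<not> gauss_quadrature I x y (2 * r)"
proof
  assume "gauss_quadrature I x y (2 * r)"
  then obtain c where "(\<Prod>i\<in>I. [:- y i, 1:]) = hermite (Suc r) + smult c (hermite r)"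
    using gauss_quadrature.node_polynomial_quasi_hermite assms by blast
  moreover have "has_dominant_term (sqrt 2) (\<Prod>i\<in>I. [:- y i, 1:])"
    using assms(2) by (intro has_dominant_term_prod) (auto simp: dyadic_norm_neq_sqrt2)
  ultimately show False
    using not_has_dominant_term_quasi_hermite[OF assms(1)] by metis
qed

theorem corollary5p7:
  fixes r :: nat
  assumes "r > 0"
    and "r mod 8 \<in> {2, 3, 4, 5, 6}"
  shows "\<not> (\<exists>(x :: nat \<Rightarrow> rat) (y :: nat \<Rightarrow> rat). \<forall>k\<in>{0..2 * r}.
           (\<Sum>i = 1..r + 1. real_of_rat (x i) * real_of_rat (y i) ^ k) = gauss_moment k)"
proof
  assume "\<exists>(x :: nat \<Rightarrow> rat) (y :: nat \<Rightarrow> rat). \<forall>k\<in>{0..2 * r}.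
           (\<Sum>i = 1..r + 1. real_of_rat (x i) * real_of_rat (y i) ^ k) = gauss_moment k"
  then obtain x y :: "nat \<Rightarrow> rat" where
    *: "\<And>k. k \<le> 2 * r \<Longrightarrow>
         (\<Sum>i = 1..r + 1. real_of_rat (x i) * real_of_rat (y i) ^ k) = gauss_moment k"
    by (metis atLeastAtMost_iff zero_le)
  have "gauss_quadrature {1..r + 1} x y (2 * r)"
  proof
    fix k assume "k \<le> 2 * r"
    hence "real_of_rat (\<Sum>i = 1..r + 1. x i * y i ^ k) = real_of_rat (hermite_moment k)"
      using *[of k]
      by (simp only: of_rat_sum of_rat_mult of_rat_power of_rat_hermite_moment
          gauss_moment_eq_hermite_moment)
    thus "(\<Sum>i = 1..r + 1. x i * y i ^ k) = hermite_moment k"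
      by (simp only: of_rat_eq_iff)
  qed
  moreover have "r \<ge> 2"
    using assms(2) mod_less_eq_dividend[of r 8] by auto
  ultimately show False
    using no_rational_gauss_quadrature[of r "{1..r + 1}" x y] by simp
qed

end
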